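(* Let $m,n$ be integers with $\min(m,n)\ge 3$. The complete bipartite graph $K_{m,n}$ attains the ordered multiplicity list $(1,m+n-2,1)$, but it is not spectrally arbitrary for this list. That is, there is a matrix in $\mathcal{S}(K_{m,n})$ with ordered multiplicity list $(1,m+n-2,1)$, but it is not true that for all reals $\lambda_1<\lambda_2<\lambda_3$ there is $M\in\mathcal{S}(K_{m,n})$ with spectrum $\{\lambda_1^{(1)},\lambda_2^{(m+n-2)},\lambda_3^{(1)}\}$.
   Context: For a simple graph $G$ with vertices $v_1,\dots,v_N$, $\mathcal{S}(G)$ is the set of real symmetric $N\times N$ matrices $M$ such that for all $i\ne j$, $M_{i,j}=0$ if and only if $v_iv_j\notin E(G)$; diagonal entries are unrestricted. If $M$ has distinct eigenvalues $\lambda_1<\cdots<\lambda_k$ with multiplicities $\gamma_1,\dots,\gamma_k$, its ordered multiplicity list is $(\gamma_1,\dots,\gamma_k)$ and its spectrum is written $\{\lambda_1^{(\gamma_1)},\dots,\lambda_k^{(\gamma_k)}\}$. A graph $G$ attains a list if some $M\in\mathcal{S}(G)$ has that ordered multiplicity list. $G$ is spectrally arbitrary for $(\gamma_1,\dots,\gamma_k)$ if for any reals $\lambda_1<\cdots<\lambda_k$ there is $M\in\mathcal{S}(G)$ with spectrum $\{\lambda_1^{(\gamma_1)},\dots,\lambda_k^{(\gamma_k)}\}$. *)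

theory Defs
  imports Graph_Theory.Kuratowski Jordan_Normal_Form.Spectral_Radius
begin

text \<open>
  Simple graphs are modelled as in \<^theory>\<open>Graph_Theory.Kuratowski\<close>: a graph is a finite symmetric
  loop-free digraph without parallel arcs, and \<open>K\<^bsub>m,n\<^esub> G\<close> says that \<open>G\<close> is a complete
  bipartite graph with parts of sizes \<open>m\<close> and \<open>n\<close>.
\<close>

text \<open>
  The set \<open>\<S>(G)\<close>, with respect to the enumeration \<open>vs\<close> of the vertices of \<open>G\<close>
  (vertices and matrix indices are counted from 0).
\<close>

definition graph_matrices :: "('a, 'b) pre_digraph \<Rightarrow> 'a list \<Rightarrow> real mat set" where
  "graph_matrices G vs =
    {M \<in> carrier_mat (length vs) (length vs).
      transpose_mat M = M \<and>
      (\<forall>i<length vs. \<forall>j<length vs. i \<noteq> j \<longrightarrow>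
        (M $$ (i, j) = 0 \<longleftrightarrow> \<not> (vs ! i \<rightarrow>\<^bsub>G\<^esub> vs ! j)))}"

text \<open>
  The algebraic multiplicity; for the real symmetric matrices considered here it coincides with the
  geometric one. The qualified name avoids the order of a group.
\<close>

definition eig_mult :: "real mat \<Rightarrow> real \<Rightarrow> nat" where
  "eig_mult M l = Polynomial.order l (char_poly M)"

definition ordered_multiplicity_list :: "real mat \<Rightarrow> nat list" where
  "ordered_multiplicity_list M = map (eig_mult M) (sorted_list_of_set (spectrum M))"

definition attains :: "('a, 'b) pre_digraph \<Rightarrow> 'a list \<Rightarrow> nat list \<Rightarrow> bool" where
  "attains G vs gs \<longleftrightarrow> (\<exists>M\<in>graph_matrices G vs. ordered_multiplicity_list M = gs)"

text \<open>The spectrum with multiplicities is \<open>{ls ! 0 ^ (gs ! 0), ls ! 1 ^ (gs ! 1), \<dots>}\<close>.\<close>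

definition has_spectrum :: "real mat \<Rightarrow> real list \<Rightarrow> nat list \<Rightarrow> bool" where
  "has_spectrum M ls gs \<longleftrightarrow> spectrum M = set ls \<and> map (eig_mult M) ls = gs"

definition spectrally_arbitrary :: "('a, 'b) pre_digraph \<Rightarrow> 'a list \<Rightarrow> nat list \<Rightarrow> bool" where
  "spectrally_arbitrary G vs gs \<longleftrightarrow>
    (\<forall>ls. length ls = length gs \<longrightarrow> sorted_wrt (<) ls \<longrightarrow>
      (\<exists>M\<in>graph_matrices G vs. has_spectrum M ls gs))"

text \<open>The hypothesis \<open>K\<^bsub>m,n\<^esub> G\<close> is satisfiable for all \<open>m\<close> and \<open>n\<close>.\<close>

lemma complete_bipartite_digraph_exists: "\<exists>G :: nat pair_pre_digraph. K\<^bsub>m,n\<^esub> (with_proj G)"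
proof -
  let ?U = "{..<m}" and ?V = "{m..<m + n}"
  let ?G = "\<lparr>pverts = ?U \<union> ?V, parcs = ?U \<times> ?V \<union> ?V \<times> ?U\<rparr>"
  have "?U \<inter> ?V = {}" "card ?U = m" "card ?V = n"
    by auto
  then have "K\<^bsub>m,n\<^esub> (with_proj ?G)"
    unfolding complete_bipartite_digraph_pair_def pair_pre_digraph.simps by blast
  then show ?thesis ..
qed

end

theory Submission
  imports Defs
begin

text \<open>
  The list \<open>(1, m + n - 2, 1)\<close> is attained by the adjacency matrix, whose spectrum consists of \<open>0\<close>
  and \<open>\<plusminus>\<surd>(m n)\<close>: it is a product of an \<open>(m + n) \<times> 2\<close> and a \<open>2 \<times> (m + n)\<close> matrix, and
  Sylvester's identity (\<open>char_poly_mult_swap\<close>) reduces its characteristic polynomial to that of a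
  \<open>2 \<times> 2\<close> matrix.

  Conversely, suppose that a matrix \<open>M\<close> of the graph has spectrum \<open>a < c < b\<close> with these
  multiplicities. Being symmetric, \<open>M\<close> is such that \<open>M - c I\<close> has rank two
  (\<open>rank_factorization_of_repeated_root\<close>), so all its \<open>3 \<times> 3\<close> minors vanish. Its entries between
  the parts are all nonzero and its off-diagonal entries within a part are all zero; since both parts
  have at least three vertices, suitable minors force the diagonal of \<open>M - c I\<close> to vanish as well
  (\<open>rank_two_independent_diagonal_zero\<close>). Thus \<open>M - c I\<close> has zero diagonal blocks, and changing
  the sign of eigenvectors on one part shows that its spectrum is symmetric about \<open>0\<close>
  (\<open>bipartite_eigenvalue_reflection\<close>). Hence \<open>a + b = 2 c\<close>, which rules out for instance the
  spectrum \<open>0 < 1 < 3\<close>.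
\<close>

section \<open>Symmetric matrices with a repeated eigenvalue\<close>

text \<open>
  The kernels of \<open>A\<close> and \<open>A\<^sup>2\<close> agree because
  \<open>\<parallel>A x\<parallel>\<^sup>2 = x \<bullet> A (A x)\<close>.
\<close>

lemma symmetric_mult_twice_zero:
  fixes A :: "real mat"
  assumes A: "A \<in> carrier_mat n n" and sym: "transpose_mat A = A"
    and x: "x \<in> carrier_vec n" and zero: "A *\<^sub>v (A *\<^sub>v x) = 0\<^sub>v n"
  shows "A *\<^sub>v x = 0\<^sub>v n"
proof -
  have "(A *\<^sub>v x) \<bullet> (A *\<^sub>v x) = x \<bullet> (A *\<^sub>v (A *\<^sub>v x))"
    using transpose_vec_mult_scalar[OF A, of "x" "A *\<^sub>v x"] A x sym
    by (metis mult_mat_vec_carrier comm_scalar_prod)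
  also have "\<dots> = 0"
    using zero x by simp
  finally show ?thesis
    using conjugate_square_eq_0_vec[of "A *\<^sub>v x" n] A x
    by (simp add: conjugate_real_def)
qed

text \<open>
  For a symmetric matrix the geometric multiplicity of \<open>c\<close> is as large as the algebraic one, so
  \<open>M - c I\<close> has rank at most the number of remaining roots. The proof triangularises \<open>M\<close> with
  the copies of \<open>c\<close> listed first. Then \<open>C = Q (M - c I) P\<close> is upper triangular with zeros in
  its first \<open>k\<close> diagonal positions, and its first \<open>k\<close> columns vanish altogether: once the columns
  before column \<open>i\<close> are known to be zero, \<open>C\<close> kills column \<open>i\<close>, so \<open>(M - c I)\<^sup>2\<close> kills the
  corresponding column of \<open>P\<close>, and by symmetry so does \<open>M - c I\<close>. The remaining columns of \<open>P C\<close>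
  and rows of \<open>Q\<close> form the factorization.
\<close>

lemma rank_factorization_of_repeated_root:
  fixes M :: "real mat"
  assumes M: "M \<in> carrier_mat n n" and sym: "transpose_mat M = M"
    and cp: "char_poly M = [:- c, 1:] ^ k * (\<Prod>e\<leftarrow>fs. [:- e, 1:])"
  obtains X Y where "X \<in> carrier_mat n (length fs)" "Y \<in> carrier_mat (length fs) n"
    "M - c \<cdot>\<^sub>m 1\<^sub>m n = X * Y"
proof -
  let ?es = "replicate k c @ fs"
  have cp': "char_poly M = (\<Prod>e\<leftarrow>?es. [:- e, 1:])"
    using cp by simp
  obtain B P Q where BPQ: "schur_decomposition M ?es = (B, P, Q)"
    by (cases "schur_decomposition M ?es") auto
  from schur_decomposition[OF M cp' this]
  have wit: "similar_mat_wit M B P Q" and tri: "upper_triangular B" and diag: "diag_mat B = ?es"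
    by auto
  from similar_mat_witD2[OF M wit]
  have PQ: "P * Q = 1\<^sub>m n" "Q * P = 1\<^sub>m n" and M_eq: "M = P * B * Q"
    and B: "B \<in> carrier_mat n n" and P: "P \<in> carrier_mat n n" and Q: "Q \<in> carrier_mat n n"
    by auto
  have n: "n = k + length fs"
    using arg_cong[OF diag, of length] B by (simp add: diag_mat_def)
  define A where "A = M - c \<cdot>\<^sub>m 1\<^sub>m n"
  define C where "C = B - c \<cdot>\<^sub>m 1\<^sub>m n"
  have A: "A \<in> carrier_mat n n" and C: "C \<in> carrier_mat n n"
    using M B by (auto simp: A_def C_def)
  have A_sym: "transpose_mat A = A"
  proof (rule eq_matI)
    fix i j assume "i < dim_row A" "j < dim_col A"
    then show "transpose_mat A $$ (i, j) = A $$ (i, j)"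
      using M A arg_cong[OF sym, of "\<lambda>M. M $$ (i, j)"] by (simp add: A_def)
  qed (use A in auto)
  have "P * C * Q = P * B * Q - P * (c \<cdot>\<^sub>m 1\<^sub>m n) * Q"
    unfolding C_def using B P Q
    by (subst mult_minus_distrib_mat[of _ n n _ n], simp_all,
        subst minus_mult_distrib_mat[of _ n n _ _ n], simp_all)
  also have "P * (c \<cdot>\<^sub>m 1\<^sub>m n) * Q = c \<cdot>\<^sub>m 1\<^sub>m n"
    using P Q PQ by (simp add: mult_smult_distrib[of _ n n _ n] mult_smult_assoc_mat[of _ n n _ n])
  finally have A_eq: "A = P * C * Q"
    by (simp add: A_def M_eq)
  have C_low: "C $$ (j, i) = 0" if "i \<le> j" "j < n" "i < k" for i j
  proof (cases "i = j")
    case True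
    have "B $$ (i, i) = ?es ! i"
      unfolding diag[symmetric] using that B by (simp add: diag_mat_def)
    then show ?thesis
      using that True B by (simp add: C_def nth_append)
  next
    case False
    then show ?thesis
      using that B tri by (simp add: C_def upper_triangularD)
  qed
  have AP: "A * P = P * C"
    using A_eq P Q C PQ by (simp add: assoc_mult_mat[of _ n n _ n _ n])
  have QAP: "Q * (A * P) = C"
    unfolding AP using P Q C PQ by (simp add: assoc_mult_mat[of _ n n _ n _ n, symmetric])
  have col_C: "col C i = 0\<^sub>v n" if "i < k" for i
    using that
  proof (induction i rule: less_induct)
    case (less i)
    then have i: "i < n"
      using n by simp
    have "C $$ (j, l) * C $$ (l, i) = 0" if "j < n" "l < n" for j l
    proof (cases "l < i")
      case True
      then have "col C l $ j = 0"
        using less that by simp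
      then show ?thesis
        using that C by simp
    next
      case False
      then show ?thesis
        using C_low[of i l] that less.prems by simp
    qed
    then have CC: "C *\<^sub>v col C i = 0\<^sub>v n"
      using C i by (intro eq_vecI) (auto simp: scalar_prod_def intro!: sum.neutral)
    have x: "col P i \<in> carrier_vec n"
      using P by auto
    have Ax: "A *\<^sub>v col P i = P *\<^sub>v col C i"
      using col_mult2[OF A P i] col_mult2[OF P C i] AP by simp
    have "A *\<^sub>v (A *\<^sub>v col P i) = (A * P) *\<^sub>v col C i"
      unfolding Ax using A P C i by (simp add: assoc_mult_mat_vec[of _ n n _ n])
    also have "\<dots> = P *\<^sub>v (C *\<^sub>v col C i)"
      unfolding AP by (rule assoc_mult_mat_vec[OF P C]) (use C in auto)
    also have "\<dots> = 0\<^sub>v n"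
      using CC P by (auto intro!: eq_vecI)
    finally have "A *\<^sub>v col P i = 0\<^sub>v n"
      by (rule symmetric_mult_twice_zero[OF A A_sym x])
    moreover have "col C i = Q *\<^sub>v (A *\<^sub>v col P i)"
      using col_mult2[OF A P i] col_mult2[OF Q mult_carrier_mat[OF A P] i] QAP by simp
    ultimately show ?case
      using Q by (auto intro!: eq_vecI)
  qed
  define X where "X = mat n (length fs) (\<lambda>(i, l). (P * C) $$ (i, k + l))"
  define Y where "Y = mat (length fs) n (\<lambda>(l, j). Q $$ (k + l, j))"
  have "A $$ (i, j) = (X * Y) $$ (i, j)" if "i < n" "j < n" for i j
  proof -
    have PC0: "(P * C) $$ (i, l) = 0" if "l < k" for l
    proof -
      have "(P * C) $$ (i, l) = row P i \<bullet> col C l"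
        using \<open>i < n\<close> that n P C by simp
      then show ?thesis
        using col_C[OF that] P \<open>i < n\<close> by simp
    qed
    have "A $$ (i, j) = row (P * C) i \<bullet> col Q j"
      unfolding A_eq using that P Q C by (subst index_mult_mat(1)) auto
    also have "\<dots> = (\<Sum>l<n. (P * C) $$ (i, l) * Q $$ (l, j))"
      using that P Q C by (simp add: scalar_prod_def[of _ "col Q j"] lessThan_atLeast0)
    also have "\<dots> = (\<Sum>l\<in>{k..<n}. (P * C) $$ (i, l) * Q $$ (l, j))"
      by (rule sum.mono_neutral_right) (use PC0 in auto)
    also have "\<dots> = (\<Sum>l<length fs. (P * C) $$ (i, k + l) * Q $$ (k + l, j))"
      by (rule sum.reindex_bij_witness[of _ "\<lambda>l. k + l" "\<lambda>l. l - k"]) (use n in auto)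
    also have "\<dots> = (X * Y) $$ (i, j)"
      using that by (simp add: X_def Y_def scalar_prod_def lessThan_atLeast0)
    finally show ?thesis .
  qed
  then have "A = X * Y"
    using A by (intro eq_matI) (auto simp: X_def Y_def)
  then show thesis
    by (intro that[of X Y]) (auto simp: X_def Y_def A_def)
qed

section \<open>Bipartite zero patterns of rank two\<close>

text \<open>
  All rows of \<open>A\<close> are combinations of \<open>y\<close> and \<open>w\<close>, so its \<open>3 \<times> 3\<close> minors vanish. The minor is
  written out as a polynomial because its row and column indices come from an arbitrary type.
\<close>

lemma rank_two_minor_zero:
  fixes A :: "'i \<Rightarrow> 'i \<Rightarrow> 'a :: comm_ring_1"
  assumes "\<And>i j. i \<in> I \<Longrightarrow> j \<in> I \<Longrightarrow> A i j = x i * y j + z i * w j"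
    and "{i1, i2, i3, j1, j2, j3} \<subseteq> I"
  shows "A i1 j1 * (A i2 j2 * A i3 j3 - A i2 j3 * A i3 j2)
    - A i1 j2 * (A i2 j1 * A i3 j3 - A i2 j3 * A i3 j1)
    + A i1 j3 * (A i2 j1 * A i3 j2 - A i2 j2 * A i3 j1) = 0"
  using assms(2) by (simp add: assms(1)) (simp add: algebra_simps)

text \<open>
  Think of \<open>A\<close> as a graph matrix, of \<open>S\<close> as an independent set and of \<open>v\<close> as a common
  neighbour. For distinct \<open>i\<close>, \<open>j\<close>, \<open>k\<close> in \<open>S\<close>, two minors decide the matter:
  rows \<open>i, j, k\<close> with columns \<open>i, j, v\<close> give a triangular matrix with diagonal
  \<open>A i i, A j j, A k v\<close>, so \<open>A i i\<close> or \<open>A j j\<close> is zero;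
  and if \<open>A j j\<close> is zero, then the principal minor at \<open>i, j, v\<close> reduces to
  \<open>- A i i * A j v * A v j\<close>. The third vertex \<open>k\<close> is what the bound on \<open>card S\<close> supplies.
\<close>

lemma rank_two_independent_diagonal_zero:
  fixes A :: "'i \<Rightarrow> 'i \<Rightarrow> 'a :: idom"
  assumes rank: "\<And>i j. i \<in> I \<Longrightarrow> j \<in> I \<Longrightarrow> A i j = x i * y j + z i * w j"
    and indep: "\<And>i j. i \<in> S \<Longrightarrow> j \<in> S \<Longrightarrow> i \<noteq> j \<Longrightarrow> A i j = 0"
    and cross: "\<And>i. i \<in> S \<Longrightarrow> A i v \<noteq> 0 \<and> A v i \<noteq> 0"
    and S: "S \<subseteq> I" "card S \<ge> 3" and v: "v \<in> I" and i: "i \<in> S"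
  shows "A i i = 0"
proof -
  have "card (S - {i}) \<ge> 2"
    using S i by (simp add: card_Diff_singleton_if)
  then obtain D where "D \<subseteq> S - {i}" "card D = 2"
    by (meson obtain_subset_with_card_n)
  then obtain j k where jk: "j \<in> S" "k \<in> S" "j \<noteq> i" "k \<noteq> i" "j \<noteq> k"
    by (auto simp: card_2_iff)
  have mem: "i \<in> I" "j \<in> I" "k \<in> I"
    using S i jk by auto
  have "A i i * (A j j * A k v) = 0"
    using rank_two_minor_zero[where I = I and A = A, OF rank, of i j k i j v] mem v indep i jk by auto
  then have "A i i = 0 \<or> A j j = 0"
    using cross[of k] jk by simp
  moreover have "A i i = 0" if "A j j = 0"
  proof -
    have "A i i * (A j v * A v j) = 0"
      using rank_two_minor_zero[where I = I and A = A, OF rank, of i j v i j v] mem v indep i jk that by auto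
    then show ?thesis
      using cross[of j] jk by simp
  qed
  ultimately show ?thesis
    by blast
qed

text \<open>
  Up to the shift by \<open>c\<close>, the matrix only has entries between the two sides, so flipping the sign
  of an eigenvector on one side negates the shifted eigenvalue.
\<close>

lemma bipartite_eigenvalue_reflection:
  fixes M :: "real mat" and P :: "nat \<Rightarrow> bool"
  assumes M: "M \<in> carrier_mat N N"
    and same: "\<And>i j. i < N \<Longrightarrow> j < N \<Longrightarrow> i \<noteq> j \<Longrightarrow> P i = P j \<Longrightarrow> M $$ (i, j) = 0"
    and diag: "\<And>i. i < N \<Longrightarrow> M $$ (i, i) = c"
    and ev: "eigenvalue M l"
  shows "eigenvalue M (2 * c - l)"
proof -
  obtain v where v: "v \<in> carrier_vec N" "v \<noteq> 0\<^sub>v N" and Mv: "M *\<^sub>v v = l \<cdot>\<^sub>v v"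
    using ev M by (auto simp: eigenvalue_def eigenvector_def)
  define s :: "nat \<Rightarrow> real" where "s i = (if P i then 1 else - 1)" for i
  define w where "w = vec N (\<lambda>i. s i * v $ i)"
  have "(M *\<^sub>v w) $ i = ((2 * c - l) \<cdot>\<^sub>v w) $ i" if i: "i < N" for i
  proof -
    have "(M *\<^sub>v w) $ i = (\<Sum>j<N. M $$ (i, j) * (s j * v $ j))"
      using i M by (simp add: w_def scalar_prod_def lessThan_atLeast0)
    moreover have "(M *\<^sub>v v) $ i = (\<Sum>j<N. M $$ (i, j) * v $ j)"
      using i M v by (simp add: scalar_prod_def lessThan_atLeast0)
    ultimately have "(M *\<^sub>v w) $ i + s i * (M *\<^sub>v v) $ i
        = (\<Sum>j<N. M $$ (i, j) * (s j * v $ j) + s i * (M $$ (i, j) * v $ j))"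
      by (simp only: sum_distrib_left sum.distrib)
    also have "\<dots> = (\<Sum>j<N. M $$ (i, j) * (s j + s i) * v $ j)"
      by (intro sum.cong refl) (simp add: algebra_simps)
    \<comment> \<open>The factor \<open>s j + s i\<close> vanishes across the sides and the entry of \<open>M\<close> within a side, except at \<open>j = i\<close>.\<close>
    also have "\<dots> = (\<Sum>j\<in>{i}. M $$ (i, j) * (s j + s i) * v $ j)"
      by (rule sum.mono_neutral_right) (use i same[OF i] in \<open>auto simp: s_def\<close>)
    also have "\<dots> = 2 * c * s i * v $ i"
      using diag[OF i] by simp
    finally show ?thesis
      using i v by (simp add: Mv w_def algebra_simps)
  qed
  then have "M *\<^sub>v w = (2 * c - l) \<cdot>\<^sub>v w"
    using M by (intro eq_vecI) (auto simp: w_def)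
  moreover have "w \<noteq> 0\<^sub>v N"
  proof
    assume w0: "w = 0\<^sub>v N"
    have "v $ i = 0" if "i < N" for i
      using arg_cong[OF w0, of "\<lambda>u. u $ i"] that by (simp add: w_def s_def split: if_splits)
    then have "v = 0\<^sub>v N"
      using v(1) by (intro eq_vecI) auto
    with v(2) show False ..
  qed
  ultimately show ?thesis
    using M unfolding eigenvalue_def eigenvector_def
    by (intro exI[of _ w]) (auto simp: w_def)
qed

section \<open>Symmetry of the spectrum of complete bipartite graphs\<close>

text \<open>
  The enumeration of the vertices may interleave the two parts; \<open>P\<close> records which indices belong
  to the part of size \<open>m\<close>.
\<close>

lemma graph_matrices_complete_bipartite:
  assumes K: "K\<^bsub>m,n\<^esub> G" and vs: "distinct vs" "set vs = verts G"
  obtains P where "length vs = m + n"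
    "card {i. i < m + n \<and> P i} = m" "card {i. i < m + n \<and> \<not> P i} = n"
    "graph_matrices G vs = {M \<in> carrier_mat (m + n) (m + n). transpose_mat M = M \<and>
      (\<forall>i<m + n. \<forall>j<m + n. i \<noteq> j \<longrightarrow> (M $$ (i, j) = 0 \<longleftrightarrow> P i = P j))}"
proof -
  obtain U W where UW: "verts G = U \<union> W" "U \<inter> W = {}" "card U = m" "card W = n"
    and arcs: "arcs_ends G = U \<times> W \<union> W \<times> U"
    using K by (auto simp: complete_bipartite_digraph_def)
  have fin: "finite U" "finite W"
    using vs(2) UW(1) by (metis List.finite_set finite_Un)+
  have len: "length vs = m + n"
    using vs UW fin by (metis card_Un_disjoint distinct_card)
  have mem: "vs ! i \<in> U \<longleftrightarrow> vs ! i \<notin> W" if "i < m + n" for i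
    using that len vs UW nth_mem[of i vs] by auto
  have bij: "bij_betw (nth vs) {i. i < m + n \<and> vs ! i \<in> X} X" if "X \<subseteq> set vs" for X
    unfolding bij_betw_def
  proof
    show "inj_on (nth vs) {i. i < m + n \<and> vs ! i \<in> X}"
      using vs(1) len by (auto simp: inj_on_def nth_eq_iff_index_eq)
    show "nth vs ` {i. i < m + n \<and> vs ! i \<in> X} = X"
      using that len by (fastforce simp: in_set_conv_nth image_iff subset_iff)
  qed
  have "card {i. i < m + n \<and> vs ! i \<in> U} = m"
    using bij_betw_same_card[OF bij[of U]] UW vs by auto
  moreover have "card {i. i < m + n \<and> vs ! i \<notin> U} = n"
  proof -
    have "{i. i < m + n \<and> vs ! i \<notin> U} = {i. i < m + n \<and> vs ! i \<in> W}"
      using mem by auto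
    then show ?thesis
      using bij_betw_same_card[OF bij[of W]] UW vs by auto
  qed
  moreover have "vs ! i \<rightarrow>\<^bsub>G\<^esub> vs ! j \<longleftrightarrow> (vs ! i \<in> U) \<noteq> (vs ! j \<in> U)" if "i < m + n" "j < m + n" for i j
    using mem[OF that(1)] mem[OF that(2)] arcs by auto
  then have "graph_matrices G vs = {M \<in> carrier_mat (m + n) (m + n). transpose_mat M = M \<and>
      (\<forall>i<m + n. \<forall>j<m + n. i \<noteq> j \<longrightarrow> (M $$ (i, j) = 0 \<longleftrightarrow> (vs ! i \<in> U) = (vs ! j \<in> U)))}"
    unfolding graph_matrices_def len by auto
  ultimately show thesis
    using len by (intro that[of "\<lambda>i. vs ! i \<in> U"]) auto
qed

text \<open>
  The multiplicities add up to the degree of the characteristic polynomial, which leaves no room for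
  a further factor, in particular none without real roots.
\<close>

lemma char_poly_of_spectrum_simple_extremes:
  fixes M :: "real mat"
  assumes M: "M \<in> carrier_mat N N" and N: "N \<ge> 2"
    and spec: "has_spectrum M [a, c, b] [1, N - 2, 1]" and distinct: "a \<noteq> c" "c \<noteq> b" "a \<noteq> b"
  shows "char_poly M = [:- c, 1:] ^ (N - 2) * (\<Prod>e\<leftarrow>[a, b]. [:- e, 1:])"
proof -
  let ?p = "char_poly M"
  have monic: "degree ?p = N" "lead_coeff ?p = 1"
    using degree_monic_char_poly[OF M] by auto
  have ab: "poly ?p a = 0" "poly ?p b = 0" and ord: "order c ?p = N - 2"
    using spec spectrum_root_char_poly[OF M] by (auto simp: has_spectrum_def eig_mult_def)
  obtain q where q: "?p = [:- c, 1:] ^ (N - 2) * q"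
    using order_1[of c ?p] unfolding ord by (auto elim: dvdE)
  have "poly q a = 0"
    using ab distinct unfolding q by (simp add: poly_power)
  then obtain r where r: "q = [:- a, 1:] * r"
    by (auto simp: poly_eq_0_iff_dvd elim: dvdE)
  have "poly r b = 0"
    using ab distinct unfolding q r by (simp add: poly_power)
  then obtain t where t: "r = [:- b, 1:] * t"
    by (auto simp: poly_eq_0_iff_dvd elim: dvdE)
  have p: "?p = ([:- c, 1:] ^ (N - 2) * (\<Prod>e\<leftarrow>[a, b]. [:- e, 1:])) * t" (is "_ = ?g * t")
    unfolding q r t by (simp only: list.map prod_list.Cons prod_list.Nil mult_1_right mult.assoc)
  have g: "lead_coeff ?g = 1"
    by (simp only: lead_coeff_mult lead_coeff_power list.map prod_list.Cons prod_list.Nil) simp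
  have "degree ?g = N"
    using N by (simp add: degree_mult_eq degree_power_eq del: mult_pCons_left mult_pCons_right)
  have "t \<noteq> 0"
    using p monic by auto
  then have "degree t = 0"
    using arg_cong[OF p, of degree] \<open>degree ?g = N\<close> g monic degree_mult_eq[of ?g t] by force
  moreover have "lead_coeff t = 1"
    using arg_cong[OF p, of lead_coeff] g monic(2) by (simp only: lead_coeff_mult mult_1_left)
  ultimately have "t = 1"
    by (auto elim!: degree_eq_zeroE simp: one_pCons)
  then show ?thesis
    using p by simp
qed

text \<open>
  This is the obstruction to spectral arbitrariness. The matrix \<open>M - c I\<close> has rank two, hence zero
  diagonal, so the spectrum of \<open>M\<close> is invariant under reflection in \<open>c\<close>, and that reflection can
  only exchange \<open>a\<close> and \<open>b\<close>.
\<close>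

lemma complete_bipartite_extremes_symmetric:
  fixes M :: "real mat"
  assumes min: "min m n \<ge> 3" and K: "K\<^bsub>m,n\<^esub> G" and vs: "distinct vs" "set vs = verts G"
    and M: "M \<in> graph_matrices G vs"
    and spec: "has_spectrum M [a, c, b] [1, m + n - 2, 1]" and lt: "a < c" "c < b"
  shows "a + b = 2 * c"
proof -
  let ?N = "m + n"
  obtain P where card: "card {i. i < ?N \<and> P i} = m" "card {i. i < ?N \<and> \<not> P i} = n"
    and gm: "graph_matrices G vs = {M \<in> carrier_mat ?N ?N. transpose_mat M = M \<and>
      (\<forall>i<?N. \<forall>j<?N. i \<noteq> j \<longrightarrow> (M $$ (i, j) = 0 \<longleftrightarrow> P i = P j))}"
    by (rule graph_matrices_complete_bipartite[OF K vs])
  from M gm have Mc: "M \<in> carrier_mat ?N ?N" and sym: "transpose_mat M = M"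
    and zero: "\<And>i j. i < ?N \<Longrightarrow> j < ?N \<Longrightarrow> i \<noteq> j \<Longrightarrow> M $$ (i, j) = 0 \<longleftrightarrow> P i = P j"
    by auto
  have N: "?N \<ge> 2"
    using min by simp
  obtain X Y where X: "X \<in> carrier_mat ?N (length [a, b])" and Y: "Y \<in> carrier_mat (length [a, b]) ?N"
    and XY: "M - c \<cdot>\<^sub>m 1\<^sub>m ?N = X * Y"
    using rank_factorization_of_repeated_root[OF Mc sym
        char_poly_of_spectrum_simple_extremes[OF Mc N spec]] lt by auto
  define A where "A i j = (M - c \<cdot>\<^sub>m 1\<^sub>m ?N) $$ (i, j)" for i j
  have A: "A i j = M $$ (i, j) - (if i = j then c else 0)" if "i < ?N" "j < ?N" for i j
    using that Mc by (simp add: A_def)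
  have rank: "A i j = X $$ (i, 0) * Y $$ (0, j) + X $$ (i, 1) * Y $$ (1, j)"
    if "i \<in> {..<?N}" "j \<in> {..<?N}" for i j
    unfolding A_def XY using that X Y by (simp add: scalar_prod_def)
  have diag0: "A i i = 0" if i: "i < ?N" for i
  proof -
    let ?S = "{j. j < ?N \<and> P j = P i}"
    have S3: "card ?S \<ge> 3"
      using card min by (cases "P i") auto
    obtain v where v: "v < ?N" "P v \<noteq> P i"
    proof -
      have "card {j. j < ?N \<and> P j \<noteq> P i} \<ge> 3"
        using card min by (cases "P i") auto
      then have "{j. j < ?N \<and> P j \<noteq> P i} \<noteq> {}"
        by (metis card.empty not_numeral_le_zero)
      then show thesis
        using that by auto
    qed
    show ?thesis
    proof (rule rank_two_independent_diagonal_zero[where A = A and I = "{..<?N}" and S = ?S and v = v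
          and x = "\<lambda>j. X $$ (j, 0)" and y = "\<lambda>k. Y $$ (0, k)"
          and z = "\<lambda>j. X $$ (j, 1)" and w = "\<lambda>k. Y $$ (1, k)"])
      show "A j k = X $$ (j, 0) * Y $$ (0, k) + X $$ (j, 1) * Y $$ (1, k)"
        if "j \<in> {..<?N}" "k \<in> {..<?N}" for j k
        using that by (rule rank)
      show "A j k = 0" if "j \<in> ?S" "k \<in> ?S" "j \<noteq> k" for j k
        using that A[of j k] zero[of j k] by simp
      show "A j v \<noteq> 0 \<and> A v j \<noteq> 0" if j: "j \<in> ?S" for j
      proof -
        have "j \<noteq> v"
          using j v by blast
        then show ?thesis
          using j v A[of j v] A[of v j] zero[of j v] zero[of v j] by auto
      qed
    qed (use S3 v i in auto)
  qed
  have spectrum: "spectrum M = {a, c, b}"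
    using spec by (simp add: has_spectrum_def)
  have "eigenvalue M (2 * c - a)"
  proof (rule bipartite_eigenvalue_reflection[OF Mc, where P = P])
    show "M $$ (i, j) = 0" if "i < ?N" "j < ?N" "i \<noteq> j" "P i = P j" for i j
      using zero[OF that(1-3)] that(4) by simp
    show "M $$ (i, i) = c" if "i < ?N" for i
      using diag0[OF that] A[OF that that] by simp
    show "eigenvalue M a"
      using spectrum unfolding spectrum_def by (metis insertI1 mem_Collect_eq)
  qed
  then have "2 * c - a \<in> {a, c, b}"
    unfolding spectrum[symmetric] spectrum_def by (rule CollectI)
  then show ?thesis
    using lt by fastforce
qed

section \<open>Spectrum of the adjacency matrix\<close>

lemma has_spectrum_imp_ordered_multiplicity_list:
  assumes "has_spectrum M ls gs" and "sorted_wrt (<) ls"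
  shows "ordered_multiplicity_list M = gs"
  using assms
  by (simp add: has_spectrum_def ordered_multiplicity_list_def strict_sorted_iff
      sorted_list_of_set.idem_if_sorted_distinct)

lemma has_spectrum_simple_extremes_of_char_poly:
  fixes M :: "real mat"
  assumes M: "M \<in> carrier_mat N N" and k: "k > 0"
    and cp: "char_poly M = [:- c, 1:] ^ k * ([:- a, 1:] * [:- b, 1:])"
    and distinct: "a \<noteq> c" "c \<noteq> b" "a \<noteq> b"
  shows "has_spectrum M [a, c, b] [1, k, 1]"
proof -
  have "order l (char_poly M) = (if l = c then k else 0) + ((if l = a then 1 else 0) + (if l = b then 1 else 0))" for l
  proof -
    have "order l [:- e, 1:] = (if l = e then 1 else 0)" for e
      using order_power_n_n[of e 1] by (cases "l = e") (auto intro!: order_0I)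
    moreover have "order l ([:- c, 1:] ^ k) = (if l = c then k else 0)"
      using order_power_n_n[of c k] by (cases "l = c") (auto intro!: order_0I simp: poly_power)
    moreover have "[:- c, 1:] ^ k * ([:- a, 1:] * [:- b, 1:]) \<noteq> 0"
      "[:- a, 1:] * [:- b, 1:] \<noteq> 0"
      by (simp_all del: mult_pCons_left mult_pCons_right)
    note this[THEN order_mult, of l]
    ultimately show ?thesis
      unfolding cp by presburger
  qed
  moreover have "poly (char_poly M) l = (l - c) ^ k * ((l - a) * (l - b))" for l
    unfolding cp by (simp only: poly_mult poly_power) simp
  then have "spectrum M = {a, c, b}"
    unfolding spectrum_root_char_poly[OF M] using k by auto
  ultimately show ?thesis
    using distinct by (simp add: has_spectrum_def eig_mult_def)
qed

text \<open>
  Sylvester's identity. With \<open>K = [[x I, V], [x U, x I]]\<close> and \<open>R = [[I, 0], [- U, I]]\<close>, the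
  products \<open>K R\<close> and \<open>R K\<close> are block upper triangular and have equal determinants; the
  former displays \<open>x I - V U\<close>, the latter \<open>x I - U V\<close> as a diagonal block.
\<close>

lemma char_poly_mult_swap:
  fixes U V :: "'a :: field mat"
  assumes U: "U \<in> carrier_mat n p" and V: "V \<in> carrier_mat p n"
  shows "[:0, 1:] ^ p * char_poly (U * V) = [:0, 1:] ^ n * char_poly (V * U)"
proof -
  let ?x = "[:0, 1:] :: 'a poly"
  let ?c = "map_mat (\<lambda>a. [:a:])"
  define U' V' where "U' = ?c U" and "V' = ?c V"
  have U': "U' \<in> carrier_mat n p" and V': "V' \<in> carrier_mat p n"
    using U V by (auto simp: U'_def V'_def)
  have UV: "char_poly_matrix (U * V) = ?x \<cdot>\<^sub>m 1\<^sub>m n - U' * V'"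
    unfolding U'_def V'_def map_poly_mult(1)[OF U V, symmetric] char_poly_matrix_def
    by (rule eq_matI) (use U V in auto)
  have VU: "char_poly_matrix (V * U) = ?x \<cdot>\<^sub>m 1\<^sub>m p - V' * U'"
    unfolding U'_def V'_def map_poly_mult(1)[OF V U, symmetric] char_poly_matrix_def
    by (rule eq_matI) (use U V in auto)
  let ?K = "four_block_mat (?x \<cdot>\<^sub>m 1\<^sub>m p) V' (?x \<cdot>\<^sub>m U') (?x \<cdot>\<^sub>m 1\<^sub>m n)"
  let ?R = "four_block_mat (1\<^sub>m p) (0\<^sub>m p n) (- U') (1\<^sub>m n)"
  have "?K * ?R = four_block_mat (?x \<cdot>\<^sub>m 1\<^sub>m p - V' * U') V' (0\<^sub>m n p) (?x \<cdot>\<^sub>m 1\<^sub>m n)"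
    by (subst mult_four_block_mat[of _ p p _ n _ n])
       (use U' V' in \<open>auto intro!: eq_matI cong_four_block_mat\<close>)
  moreover have "?R * ?K = four_block_mat (?x \<cdot>\<^sub>m 1\<^sub>m p) V' (0\<^sub>m n p) (?x \<cdot>\<^sub>m 1\<^sub>m n - U' * V')"
    by (subst mult_four_block_mat[of _ p p _ n _ n])
       (use U' V' in \<open>auto intro!: eq_matI cong_four_block_mat\<close>)
  moreover have "det (?K * ?R) = det (?R * ?K)"
    by (subst (1 2) det_mult[of _ "p + n"]) (use U' V' in auto)
  ultimately have "det (four_block_mat (?x \<cdot>\<^sub>m 1\<^sub>m p - V' * U') V' (0\<^sub>m n p) (?x \<cdot>\<^sub>m 1\<^sub>m n))
      = det (four_block_mat (?x \<cdot>\<^sub>m 1\<^sub>m p) V' (0\<^sub>m n p) (?x \<cdot>\<^sub>m 1\<^sub>m n - U' * V'))"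
    by simp
  then have "det (?x \<cdot>\<^sub>m 1\<^sub>m p - V' * U') * det (?x \<cdot>\<^sub>m 1\<^sub>m n)
      = det (?x \<cdot>\<^sub>m 1\<^sub>m p) * det (?x \<cdot>\<^sub>m 1\<^sub>m n - U' * V')"
    by (subst (asm) (1 2) det_four_block_mat_lower_left_zero[of _ p _ n]) (use U' V' in auto)
  then show ?thesis
    by (simp add: char_poly_def UV VU det_smult mult.commute)
qed

lemma det_2_by_2:
  assumes "A \<in> carrier_mat 2 2"
  shows "det A = A $$ (0, 0) * A $$ (1, 1) - A $$ (0, 1) * A $$ (1, 0)"
proof -
  have "mat_delete A i 0 \<in> carrier_mat 1 1" for i
    using assms by (auto simp: mat_delete_def)
  then show ?thesis
    using assms
    by (subst laplace_expansion_column[OF assms, of 0])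
       (auto simp: cofactor_def det_single mat_delete_def numeral_2_eq_2)
qed

text \<open>
  The adjacency matrix is \<open>U V\<close>, where the two columns of \<open>U\<close> are the indicator vectors of the
  parts and the two rows of \<open>V\<close> are the same vectors in the opposite order. Swapping the factors
  leaves the \<open>2 \<times> 2\<close> matrix with zero diagonal and off-diagonal entries \<open>m\<close> and \<open>n\<close>.
\<close>

lemma char_poly_complete_bipartite_adjacency:
  fixes m n :: nat
  assumes "card {i. i < m + n \<and> P i} = m" "card {i. i < m + n \<and> \<not> P i} = n" "m + n \<ge> 2"
  shows "char_poly (mat (m + n) (m + n) (\<lambda>(i, j). if P i = P j then 0 else 1 :: real))
    = [:0, 1:] ^ (m + n - 2) * [:- of_nat (m * n), 0, 1:]"
proof -
  let ?N = "m + n" and ?x = "[:0, 1:] :: real poly"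
  define U where "U = mat ?N 2 (\<lambda>(i, l). if (l = 0) = P i then 1 else 0 :: real)"
  define V where "V = mat 2 ?N (\<lambda>(l, j). if (l = 0) = P j then 0 else 1 :: real)"
  have U: "U \<in> carrier_mat ?N 2" and V: "V \<in> carrier_mat 2 ?N"
    by (auto simp: U_def V_def)
  have UV: "U * V = mat ?N ?N (\<lambda>(i, j). if P i = P j then 0 else 1)"
    by (rule eq_matI) (auto simp: U_def V_def scalar_prod_def numeral_2_eq_2)
  have VU_entry: "(V * U) $$ (l, k) = (\<Sum>j<?N. (if (l = 0) = P j then 0 else 1) * (if (k = 0) = P j then 1 else 0))"
    if "l < 2" "k < 2" for l k
    using that by (simp add: U_def V_def scalar_prod_def lessThan_atLeast0)
  have "(V * U) $$ (0, 0) = 0" "(V * U) $$ (1, 1) = 0"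
    by (auto simp: VU_entry intro!: sum.neutral)
  moreover have "(V * U) $$ (1, 0) = of_nat m"
  proof -
    have "(V * U) $$ (1, 0) = (\<Sum>j<?N. if P j then 1 else 0)"
      by (simp add: VU_entry cong: if_cong) (rule sum.cong, auto)
    also have "\<dots> = of_nat (card {j. j < ?N \<and> P j})"
      by (simp add: sum.inter_filter[symmetric] del: sum.inter_filter)
    finally show ?thesis
      by (simp only: assms)
  qed
  moreover have "(V * U) $$ (0, 1) = of_nat n"
  proof -
    have "(V * U) $$ (0, 1) = (\<Sum>j<?N. if \<not> P j then 1 else 0)"
      by (simp add: VU_entry cong: if_cong) (rule sum.cong, auto)
    also have "\<dots> = of_nat (card {j. j < ?N \<and> \<not> P j})"
      by (simp add: sum.inter_filter[symmetric] del: sum.inter_filter)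
    finally show ?thesis
      by (simp only: assms)
  qed
  ultimately have "char_poly (V * U) = [:- of_nat (m * n), 0, 1:]"
    using U V by (simp add: char_poly_def det_2_by_2 char_poly_matrix_def)
  then have "?x ^ 2 * char_poly (U * V) = ?x ^ ?N * [:- of_nat (m * n), 0, 1:]"
    using char_poly_mult_swap[OF U V] by simp
  also have "?x ^ ?N = ?x ^ 2 * ?x ^ (?N - 2)"
    using assms(3) by (metis le_add_diff_inverse power_add)
  finally have "char_poly (U * V) = ?x ^ (?N - 2) * [:- of_nat (m * n), 0, 1:]"
    by (simp only: mult.assoc mult_left_cancel) simp
  then show ?thesis
    unfolding UV .
qed

section \<open>The multiplicity list with simple extremes\<close>

theorem theorem28:
  fixes m n :: nat and G :: "('a, 'b) pre_digraph" and vs :: "'a list"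
  assumes "min m n \<ge> 3"
    and "K\<^bsub>m,n\<^esub> G"
    and "distinct vs" and "set vs = verts G"
  shows "attains G vs [1, m + n - 2, 1] \<and> \<not> spectrally_arbitrary G vs [1, m + n - 2, 1]"
proof
  let ?N = "m + n"
  obtain P where card: "card {i. i < ?N \<and> P i} = m" "card {i. i < ?N \<and> \<not> P i} = n"
    and gm: "graph_matrices G vs = {M \<in> carrier_mat ?N ?N. transpose_mat M = M \<and>
      (\<forall>i<?N. \<forall>j<?N. i \<noteq> j \<longrightarrow> (M $$ (i, j) = 0 \<longleftrightarrow> P i = P j))}"
    by (rule graph_matrices_complete_bipartite[OF assms(2-4)])
  define A where "A = mat ?N ?N (\<lambda>(i, j). if P i = P j then 0 else 1 :: real)"
  define s where "s = sqrt (real (m * n))"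
  have A: "A \<in> carrier_mat ?N ?N"
    by (simp add: A_def)
  have s: "s > 0" "s * s = real (m * n)"
    using assms(1) by (auto simp: s_def)
  have "char_poly A = [:0, 1:] ^ (?N - 2) * [:- real (m * n), 0, 1:]"
    unfolding A_def by (rule char_poly_complete_bipartite_adjacency) (use card assms(1) in auto)
  also have "[:- real (m * n), 0, 1:] = [:- (- s), 1:] * [:- s, 1:]"
    using s(2) by simp
  finally have "has_spectrum A [- s, 0, s] [1, ?N - 2, 1]"
    using s(1) assms(1) by (intro has_spectrum_simple_extremes_of_char_poly[OF A]) auto
  then have "ordered_multiplicity_list A = [1, ?N - 2, 1]"
    using s(1) by (intro has_spectrum_imp_ordered_multiplicity_list) auto
  moreover have "A \<in> graph_matrices G vs"
    unfolding gm by (auto simp: A_def intro!: eq_matI)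
  ultimately show "attains G vs [1, ?N - 2, 1]"
    unfolding attains_def by blast
next
  show "\<not> spectrally_arbitrary G vs [1, m + n - 2, 1]"
  proof
    assume "spectrally_arbitrary G vs [1, m + n - 2, 1]"
    then obtain M where "M \<in> graph_matrices G vs" "has_spectrum M [0, 1, 3] [1, m + n - 2, 1]"
      unfolding spectrally_arbitrary_def by (elim allE[of _ "[0, 1, 3]"]) auto
    \<comment> \<open>The reflection in \<open>1\<close> would have to exchange \<open>0\<close> and \<open>3\<close>.\<close>
    then show False
      using complete_bipartite_extremes_symmetric[OF assms, of M 0 1 3] by simp
  qed
qed

end
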